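(* (i) The algebra $S^{B_2}$ is generated by $S_1=x_1^2+x_2^2$, $S_2=x_1^2x_2^2$, $T_1=y_1^2+y_2^2$, $T_2=y_1^2y_2^2$, $Z_1=x_1y_1+x_2y_2$, $Z_2=x_1y_1x_2y_2$, $Z_3=x_1y_1^3+x_2y_2^3$ and $Z_4=x_1^3y_1+x_2^3y_2$. (ii) Put $R=\mathbb{C}[S_1,T_1,S_2,T_2]$; it is a polynomial algebra in four variables. Every element $Q$ of $S^{B_2}$ can be written uniquely as $$Q=P_0+P_1Z_1+P_2Z_1^2+P_3Z_1^3+P_4Z_1^4+Q_2Z_2+Q_3Z_3+Q_4Z_4,$$ where the $P_i$ and $Q_j$ are elements of $R$. (iii) $S^{B_2}$ is presented, as a commutative $\mathbb{C}$-algebra, by the generators $S_1,T_1,S_2,T_2,Z_1,Z_2,Z_3,Z_4$ and the relations $$\begin{aligned} Z_1^5&=\left(16S_2T_2-5S_2T_1^2-5S_1^2T_2+\tfrac{S_1^2T_1^2}{2}\right)Z_1+\tfrac{3S_1T_1}{2}Z_1^3+\left(4S_2T_1-\tfrac{S_1^2T_1}{2}\right)Z_3+\left(4S_1T_2-\tfrac{S_1T_1^2}{2}\right)Z_4,\\ Z_1Z_2&=\tfrac{S_1T_1}{4}Z_1+\tfrac14Z_1^3-\tfrac{S_1}{4}Z_3-\tfrac{T_1}{4}Z_4,\\ Z_1Z_3&=-S_1T_2+T_1Z_1^2-T_1Z_2,\\ Z_1Z_4&=-S_2T_1+S_1Z_1^2-S_1Z_2,\\ Z_2^2&=S_2T_2,\\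 Z_2Z_3&=\left(\tfrac{S_1T_1^2}{4}-S_1T_2\right)Z_1+\tfrac{T_1}{4}Z_1^3-\tfrac{S_1T_1}{4}Z_3+\left(T_2-\tfrac{T_1^2}{4}\right)Z_4,\\ Z_2Z_4&=\left(\tfrac{S_1^2T_1}{4}-S_2T_1\right)Z_1+\tfrac{S_1}{4}Z_1^3+\left(S_2-\tfrac{S_1^2}{4}\right)Z_3-\tfrac{S_1T_1}{4}Z_4,\\ Z_3^2&=-S_1T_1T_2+(T_1^2-T_2)Z_1^2+(4T_2-2T_1^2)Z_2,\\ Z_3Z_4&=4S_2T_2-\tfrac{5S_2T_1^2}{4}-\tfrac{5S_1^2T_2}{4}+\tfrac{5S_1T_1}{4}Z_1^2-\tfrac14Z_1^4-\tfrac{3S_1T_1}{2}Z_2,\\ Z_4^2&=-S_1S_2T_1+(S_1^2-S_2)Z_1^2+(4S_2-2S_1^2)Z_2. \end{aligned}$$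
   Context: $S=\mathbb{C}[x_1,x_2,y_1,y_2]$. The group $B_2=\{\pm1\}^2\rtimes S_2$ acts on $S$ by algebra automorphisms: $(\epsilon,\epsilon',\mathrm{id})$ sends $x_1\mapsto\epsilon x_1$, $y_1\mapsto \epsilon y_1$, $x_2\mapsto\epsilon' x_2$, $y_2\mapsto\epsilon' y_2$, and $(\epsilon,\epsilon',(12))$ sends $x_1\mapsto\epsilon'x_2$, $y_1\mapsto\epsilon'y_2$, $x_2\mapsto\epsilon x_1$, $y_2\mapsto\epsilon y_1$. $S^{B_2}$ is the algebra of invariants. *)

theory Defs
  imports Complex_Main "HOL-Library.Poly_Mapping" "HOL-Algebra.Group"
begin

section \<open>Polynomial rings over the complex numbers\<close>

text \<open>Polynomials with complex coefficients in the variables of type \<open>'v\<close>: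
  a monomial is a finitely supported exponent function, a polynomial a finitely
  supported coefficient function on monomials.\<close>

type_synonym 'v cpoly = "('v \<Rightarrow>\<^sub>0 nat) \<Rightarrow>\<^sub>0 complex"

definition Cst :: "complex \<Rightarrow> 'v cpoly" where
  "Cst c = Poly_Mapping.single 0 c"

definition Var :: "'v \<Rightarrow> 'v cpoly" where
  "Var v = Poly_Mapping.single (Poly_Mapping.single v 1) 1"

text \<open>The \<open>\<complex>\<close>-algebra homomorphism sending each variable \<open>v\<close> to \<open>h v\<close>:\<close>

definition psubst :: "('v \<Rightarrow> 'w cpoly) \<Rightarrow> 'v cpoly \<Rightarrow> 'w cpoly" where
  "psubst h p = (\<Sum>m\<in>Poly_Mapping.keys p.
     Cst (Poly_Mapping.lookup p m) *
     (\<Prod>v\<in>Poly_Mapping.keys m. h v ^ Poly_Mapping.lookup m v))"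

definition subalgebra :: "'v cpoly set \<Rightarrow> bool" where
  "subalgebra A \<longleftrightarrow> range Cst \<subseteq> A \<and> (\<forall>p\<in>A. \<forall>q\<in>A. p + q \<in> A \<and> p * q \<in> A)"

abbreviation subalgebra_gen :: "'v cpoly set \<Rightarrow> 'v cpoly set" where
  "subalgebra_gen G \<equiv> subalgebra hull G"

lemma module_mult: "module ((*) :: 'a \<Rightarrow> 'a \<Rightarrow> 'a::comm_ring_1)"
  by unfold_locales (simp_all add: algebra_simps)

text \<open>The submodules of a commutative ring, viewed as a module over itself, are its ideals.\<close>

abbreviation ideal_gen :: "'a::comm_ring_1 set \<Rightarrow> 'a set" where
  "ideal_gen \<equiv> module.span (*)"

text \<open>The algebra \<open>A\<close> is presented by the generators \<open>h v\<close> and the relations \<open>rels\<close>: the evaluation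
  homomorphism from the free commutative algebra has image \<open>A\<close> and kernel the ideal generated
  by \<open>rels\<close>.\<close>

definition is_presentation :: "('v \<Rightarrow> 'w cpoly) \<Rightarrow> 'v cpoly set \<Rightarrow> 'w cpoly set \<Rightarrow> bool" where
  "is_presentation h rels A \<longleftrightarrow>
     range (psubst h) = A \<and> {p. psubst h p = 0} = ideal_gen rels"


section \<open>The group \<open>B\<^sub>2\<close> and its invariants\<close>

datatype xyvar = X1 | X2 | Y1 | Y2

abbreviation x1 :: "xyvar cpoly" where "x1 \<equiv> Var X1"
abbreviation x2 :: "xyvar cpoly" where "x2 \<equiv> Var X2"
abbreviation y1 :: "xyvar cpoly" where "y1 \<equiv> Var Y1"
abbreviation y2 :: "xyvar cpoly" where "y2 \<equiv> Var Y2"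

text \<open>An element of \<open>B\<^sub>2 = {\<plusminus>1}\<^sup>2 \<rtimes> S\<^sub>2\<close> is a triple; the Boolean component is
  \<open>True\<close> for the transposition \<open>(12)\<close> and \<open>False\<close> for the identity.\<close>

definition B2 :: "(complex \<times> complex \<times> bool) monoid" where
  "B2 = \<lparr>carrier = {1, -1} \<times> {1, -1} \<times> UNIV,
         monoid.mult = (\<lambda>(a, a', s) (b, b', t).
            (a * (if s then b' else b), a' * (if s then b else b'), s \<noteq> t)),
         one = (1, 1, False)\<rparr>"

fun act_var :: "complex \<times> complex \<times> bool \<Rightarrow> xyvar \<Rightarrow> xyvar cpoly" where
  "act_var (e, e', False) X1 = Cst e * x1"
| "act_var (e, e', False) Y1 = Cst e * y1"
| "act_var (e, e', False) X2 = Cst e' * x2"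
| "act_var (e, e', False) Y2 = Cst e' * y2"
| "act_var (e, e', True) X1 = Cst e' * x2"
| "act_var (e, e', True) Y1 = Cst e' * y2"
| "act_var (e, e', True) X2 = Cst e * x1"
| "act_var (e, e', True) Y2 = Cst e * y1"

definition act :: "complex \<times> complex \<times> bool \<Rightarrow> xyvar cpoly \<Rightarrow> xyvar cpoly" where
  "act g = psubst (act_var g)"

definition invariants :: "xyvar cpoly set" where
  "invariants = {p. \<forall>g\<in>carrier B2. act g p = p}"

lemma group_B2: "group B2"
proof (rule groupI)
  fix g assume "g \<in> carrier B2"
  then obtain a a' s where g: "g = (a, a', s)" "a \<in> {1,-1}" "a' \<in> {1,-1}"
    by (auto simp: B2_def)
  show "\<exists>h\<in>carrier B2. h \<otimes>\<^bsub>B2\<^esub> g = \<one>\<^bsub>B2\<^esub>"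
    by (rule bexI[of _ "(if s then (a', a, s) else (a, a', s))"]) (use g in \<open>auto simp: B2_def\<close>)
qed (auto simp: B2_def split: if_splits)


section \<open>Generators and relations\<close>

definition S1 :: "xyvar cpoly" where "S1 = x1^2 + x2^2"
definition S2 :: "xyvar cpoly" where "S2 = x1^2 * x2^2"
definition T1 :: "xyvar cpoly" where "T1 = y1^2 + y2^2"
definition T2 :: "xyvar cpoly" where "T2 = y1^2 * y2^2"
definition Z1 :: "xyvar cpoly" where "Z1 = x1 * y1 + x2 * y2"
definition Z2 :: "xyvar cpoly" where "Z2 = x1 * y1 * x2 * y2"
definition Z3 :: "xyvar cpoly" where "Z3 = x1 * y1^3 + x2 * y2^3"
definition Z4 :: "xyvar cpoly" where "Z4 = x1^3 * y1 + x2^3 * y2"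

definition R_alg :: "xyvar cpoly set" where
  "R_alg = subalgebra_gen {S1, T1, S2, T2}"

text \<open>Formal variables for the polynomial ring in four variables and for the free commutative
  algebra on the eight generators, together with the elements they stand for.\<close>

datatype rvar = RS1 | RT1 | RS2 | RT2

fun rval :: "rvar \<Rightarrow> xyvar cpoly" where
  "rval RS1 = S1"
| "rval RT1 = T1"
| "rval RS2 = S2"
| "rval RT2 = T2"

datatype gvar = GS1 | GT1 | GS2 | GT2 | GZ1 | GZ2 | GZ3 | GZ4

fun gval :: "gvar \<Rightarrow> xyvar cpoly" where
  "gval GS1 = S1"
| "gval GT1 = T1"
| "gval GS2 = S2"
| "gval GT2 = T2"
| "gval GZ1 = Z1"
| "gval GZ2 = Z2"
| "gval GZ3 = Z3"
| "gval GZ4 = Z4"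

text \<open>A relation \<open>l = r\<close> between the generators is encoded as the polynomial \<open>l - r\<close>.\<close>

definition relations :: "gvar cpoly set" where
  "relations =
    (let s1 = Var GS1; t1 = Var GT1; s2 = Var GS2; t2 = Var GT2;
         z1 = Var GZ1; z2 = Var GZ2; z3 = Var GZ3; z4 = Var GZ4
     in
      { z1^5 - ((16 * s2 * t2 - 5 * s2 * t1^2 - 5 * s1^2 * t2 + Cst (1/2) * s1^2 * t1^2) * z1
                + Cst (3/2) * s1 * t1 * z1^3
                + (4 * s2 * t1 - Cst (1/2) * s1^2 * t1) * z3
                + (4 * s1 * t2 - Cst (1/2) * s1 * t1^2) * z4),
        z1 * z2 - (Cst (1/4) * s1 * t1 * z1 + Cst (1/4) * z1^3
                   - Cst (1/4) * s1 * z3 - Cst (1/4) * t1 * z4),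
        z1 * z3 - (- (s1 * t2) + t1 * z1^2 - t1 * z2),
        z1 * z4 - (- (s2 * t1) + s1 * z1^2 - s1 * z2),
        z2^2 - s2 * t2,
        z2 * z3 - ((Cst (1/4) * s1 * t1^2 - s1 * t2) * z1 + Cst (1/4) * t1 * z1^3
                   - Cst (1/4) * s1 * t1 * z3 + (t2 - Cst (1/4) * t1^2) * z4),
        z2 * z4 - ((Cst (1/4) * s1^2 * t1 - s2 * t1) * z1 + Cst (1/4) * s1 * z1^3
                   + (s2 - Cst (1/4) * s1^2) * z3 - Cst (1/4) * s1 * t1 * z4),
        z3^2 - (- (s1 * t1 * t2) + (t1^2 - t2) * z1^2 + (4 * t2 - 2 * t1^2) * z2),
        z3 * z4 - (4 * s2 * t2 - Cst (5/4) * s2 * t1^2 - Cst (5/4) * s1^2 * t2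
                   + Cst (5/4) * s1 * t1 * z1^2 - Cst (1/4) * z1^4
                   - Cst (3/2) * s1 * t1 * z2),
        z4^2 - (- (s1 * s2 * t1) + (s1^2 - s2) * z1^2 + (4 * s2 - 2 * s1^2) * z2) })"

end

theory Submission
  imports Defs
begin

text \<open>
  Modulo the relations every polynomial in the generators is an \<open>R\<close>-linear combination of the eight
  basis elements. These are linearly independent over \<open>R\<close>: the substitutions that change the signs of
  \<open>x1\<close>, \<open>x2\<close> and permute the two, leaving \<open>y1\<close>, \<open>y2\<close> alone, fix \<open>R\<close> and separate the coefficients.
  So the relations generate the kernel of the evaluation map, and every element of its image has
  a unique normal form. That the image contains all invariants follows by averaging: the sum of a
  monomial over \<open>B\<^sub>2\<close> is a polynomial in the polarized power sums
  \<open>x1\<^sup>a y1\<^sup>b + x2\<^sup>a y2\<^sup>b\<close> with \<open>a + b\<close> even, and these reduce to \<open>a, b < 4\<close> by the quadratic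
  equations of \<open>x1\<^sup>2, x2\<^sup>2\<close> and \<open>y1\<^sup>2, y2\<^sup>2\<close> over \<open>R\<close>.
\<close>

subsection \<open>Substitution and subalgebras\<close>

lemma Cst_0 [simp]: "Cst 0 = 0" and Cst_1 [simp]: "Cst 1 = 1"
  by (simp_all add: Cst_def)

lemma Cst_add: "Cst (a + b) = Cst a + Cst b"
  by (simp add: Cst_def single_add)

lemma Cst_mult: "Cst (a * b) = Cst a * Cst b"
  by (simp add: Cst_def mult_single)

lemma Cst_minus: "Cst (- a) = - Cst a"
  by (simp add: Cst_def single_uminus)

lemma Cst_numeral [simp]: "Cst (numeral k) = numeral k"
  by (simp add: Cst_def)

lemma Cst_power: "Cst (a ^ n) = Cst a ^ n"
  by (induction n) (simp_all add: Cst_mult)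

lemma Cst_eq_0_iff [simp]: "Cst a = 0 \<longleftrightarrow> a = 0"
  by (metis Cst_def lookup_single_eq single_zero)

text \<open>Values lie in an arbitrary commutative monoid, so that complex points and polynomial
  substitutions are treated alike.\<close>

definition monom_val :: "('v \<Rightarrow> 'a::comm_monoid_mult) \<Rightarrow> ('v \<Rightarrow>\<^sub>0 nat) \<Rightarrow> 'a" where
  "monom_val h m = (\<Prod>v\<in>Poly_Mapping.keys m. h v ^ Poly_Mapping.lookup m v)"

lemma monom_val_superset:
  assumes "finite V" "Poly_Mapping.keys m \<subseteq> V"
  shows "monom_val h m = (\<Prod>v\<in>V. h v ^ Poly_Mapping.lookup m v)"
  unfolding monom_val_def
  by (rule prod.mono_neutral_left) (use assms in \<open>auto simp: in_keys_iff\<close>)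

lemma monom_val_0 [simp]: "monom_val h 0 = 1"
  by (simp add: monom_val_def)

lemma monom_val_single [simp]: "monom_val h (Poly_Mapping.single v n) = h v ^ n"
  by (subst monom_val_superset[of "{v}"]) auto

lemma monom_val_add: "monom_val h (m + n) = monom_val h m * monom_val h n"
proof -
  let ?V = "Poly_Mapping.keys m \<union> Poly_Mapping.keys n"
  have "Poly_Mapping.keys (m + n) \<subseteq> ?V"
    by (rule keys_add)
  then show ?thesis
    by (simp add: monom_val_superset[of ?V] lookup_add power_add prod.distrib)
qed

lemma monom_val_mult: "monom_val (\<lambda>v. a v * b v) m = monom_val a m * monom_val b m"
  by (simp add: monom_val_def power_mult_distrib prod.distrib)

lemma monom_val_Cst: "monom_val (\<lambda>v. Cst (a v)) m = Cst (monom_val a m)"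
proof -
  have "(\<Prod>v\<in>V. Cst (a v) ^ k v) = Cst (\<Prod>v\<in>V. a v ^ k v)" for V k
    by (induction V rule: infinite_finite_induct) (simp_all add: Cst_mult Cst_power)
  then show ?thesis
    by (simp add: monom_val_def)
qed

lemma psubst_superset:
  assumes "finite K" "Poly_Mapping.keys p \<subseteq> K"
  shows "psubst h p = (\<Sum>m\<in>K. Cst (Poly_Mapping.lookup p m) * monom_val h m)"
  unfolding psubst_def monom_val_def
  by (rule sum.mono_neutral_left) (use assms in \<open>auto simp: in_keys_iff\<close>)

lemma psubst_single: "psubst h (Poly_Mapping.single m c) = Cst c * monom_val h m"
  by (subst psubst_superset[of "{m}"]) auto

lemma psubst_add: "psubst h (p + q) = psubst h p + psubst h q"
proof -
  let ?K = "Poly_Mapping.keys p \<union> Poly_Mapping.keys q"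
  have "Poly_Mapping.keys (p + q) \<subseteq> ?K"
    by (rule keys_add)
  then show ?thesis
    by (simp add: psubst_superset[of ?K] lookup_add Cst_add distrib_right sum.distrib)
qed

text \<open>Updating a coefficient outside the support adds a single term, so every polynomial is a
  finite sum of terms and additive properties need checking on terms only.\<close>

lemma cpoly_induct [case_names single add]:
  assumes "\<And>m c. P (Poly_Mapping.single m c)" and "\<And>p q. P p \<Longrightarrow> P q \<Longrightarrow> P (p + q)"
  shows "P (p :: 'v cpoly)"
proof (induction p rule: update_induct)
  case const
  show ?case using assms(1)[of 0 0] by simp
next
  case (update f a b)
  have "Poly_Mapping.update a b f = f + Poly_Mapping.single a b"
    using update(1)
    by (intro poly_mapping_eqI)
       (auto simp: lookup_update lookup_add lookup_single in_keys_iff when_def)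
  with update assms show ?case by simp
qed

lemma psubst_mult: "psubst h (p * q) = psubst h p * psubst h q"
proof (induction p rule: cpoly_induct)
  case (single m c)
  show ?case
    by (induction q rule: cpoly_induct)
       (simp_all add: mult_single psubst_single Cst_mult monom_val_add psubst_add
          distrib_left distrib_right mult_ac)
qed (simp add: psubst_add distrib_right)

lemma psubst_Cst [simp]: "psubst h (Cst c) = Cst c"
  by (simp add: psubst_single Cst_def[of c])

lemma psubst_Var [simp]: "psubst h (Var v) = h v"
  by (simp add: psubst_single Var_def)

lemma psubst_0 [simp]: "psubst h 0 = 0"
  using psubst_Cst[of h 0] by simp

lemma psubst_1 [simp]: "psubst h 1 = 1"
  using psubst_Cst[of h 1] by simp

lemma psubst_numeral [simp]: "psubst h (numeral k) = numeral k"
  using psubst_Cst[of h "numeral k"] by simp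

lemma psubst_uminus: "psubst h (- p) = - psubst h p"
  using psubst_add[of h p "- p"] by (simp add: minus_unique)

lemma psubst_diff: "psubst h (p - q) = psubst h p - psubst h q"
  using psubst_add[of h p "- q"] by (simp add: psubst_uminus)

lemma psubst_power: "psubst h (p ^ n) = psubst h p ^ n"
  by (induction n) (simp_all add: psubst_mult)

lemmas psubst_hom = psubst_add psubst_mult psubst_uminus psubst_diff psubst_power

lemma single_eq_monom_val: "Poly_Mapping.single m c = Cst c * monom_val Var m"
proof -
  have "monom_val Var m = Poly_Mapping.single m (1::complex)"
  proof (induction m rule: update_induct)
    case (update f a b)
    have "Poly_Mapping.update a b f = f + Poly_Mapping.single a b"
      using update(1)
      by (intro poly_mapping_eqI)
         (auto simp: lookup_update lookup_add lookup_single in_keys_iff when_def)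
    moreover have "Var a ^ b = Poly_Mapping.single (Poly_Mapping.single a b) (1::complex)"
      by (induction b) (simp_all add: Var_def mult_single single_add[symmetric])
    ultimately show ?case
      using update(3) by (simp add: monom_val_add mult_single)
  qed simp
  then show ?thesis
    by (simp add: Cst_def mult_single)
qed

section \<open>Closure properties of subalgebras and images of substitutions\<close>

lemma subalgebra_Cst: "subalgebra A \<Longrightarrow> Cst c \<in> A"
  and subalgebra_add: "subalgebra A \<Longrightarrow> p \<in> A \<Longrightarrow> q \<in> A \<Longrightarrow> p + q \<in> A"
  and subalgebra_mult: "subalgebra A \<Longrightarrow> p \<in> A \<Longrightarrow> q \<in> A \<Longrightarrow> p * q \<in> A"
  by (auto simp: subalgebra_def)

lemma subalgebra_numeral: "subalgebra A \<Longrightarrow> numeral k \<in> A"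
  using subalgebra_Cst[of A "numeral k"] by simp

lemma subalgebra_uminus: "subalgebra A \<Longrightarrow> p \<in> A \<Longrightarrow> - p \<in> A"
  using subalgebra_mult[of A "Cst (-1)" p] subalgebra_Cst[of A "-1"] by (simp add: Cst_minus)

lemma subalgebra_diff: "subalgebra A \<Longrightarrow> p \<in> A \<Longrightarrow> q \<in> A \<Longrightarrow> p - q \<in> A"
  using subalgebra_add[of A p "- q"] subalgebra_uminus[of A q] by simp

lemma subalgebra_power: "subalgebra A \<Longrightarrow> p \<in> A \<Longrightarrow> p ^ n \<in> A"
  using subalgebra_Cst[of A 1] by (induction n) (simp_all add: subalgebra_mult)

lemma psubst_in_subalgebra:
  assumes "subalgebra A" "\<And>v. h v \<in> A"
  shows "psubst h p \<in> A"
proof (induction p rule: cpoly_induct)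
  case (single m c)
  have "(\<Prod>v\<in>V. h v ^ k v) \<in> A" for V k
    using subalgebra_Cst[OF assms(1), of 1]
    by (induction V rule: infinite_finite_induct)
       (simp_all add: assms subalgebra_mult subalgebra_power)
  then show ?case
    by (simp add: psubst_single monom_val_def assms subalgebra_mult subalgebra_Cst)
qed (simp add: psubst_add assms subalgebra_add)

lemma subalgebra_range_psubst: "subalgebra (range (psubst h))"
  unfolding subalgebra_def
  by (auto simp: image_iff) (metis psubst_Cst psubst_add psubst_mult)+

lemma subalgebra_hull: "subalgebra (subalgebra_gen G)"
  by (rule hull_in) (auto simp: subalgebra_def)

text \<open>The image is itself a subalgebra containing all \<open>h v\<close>, and every subalgebra
  containing them contains all polynomial expressions in them.\<close>

lemma range_psubst: "range (psubst h) = subalgebra_gen (range h)"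
proof (rule hull_unique[symmetric])
  show "range h \<subseteq> range (psubst h)"
    by (metis image_subset_iff psubst_Var rangeI)
  show "range (psubst h) \<subseteq> B" if "range h \<subseteq> B" "subalgebra B" for B
    using psubst_in_subalgebra[of B h] that by auto
qed (rule subalgebra_range_psubst)

lemma psubst_psubst: "psubst k (psubst h p) = psubst (\<lambda>v. psubst k (h v)) p"
proof (induction p rule: cpoly_induct)
  case (single m c)
  have "psubst k (\<Prod>v\<in>V. h v ^ n v) = (\<Prod>v\<in>V. psubst k (h v) ^ n v)" for V n
    by (induction V rule: infinite_finite_induct) (simp_all add: psubst_hom)
  then show ?case
    by (simp add: psubst_single psubst_mult monom_val_def)
qed (simp add: psubst_add)

lemma psubst_Var_id: "psubst Var p = p"
  by (induction p rule: cpoly_induct)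
     (simp_all add: psubst_single single_eq_monom_val[symmetric] psubst_add)

text \<open>Monomials are multiplicative characters, so Dedekind's argument applies.\<close>

lemma monom_val_independent:
  fixes c :: "('v \<Rightarrow>\<^sub>0 nat) \<Rightarrow> complex"
  assumes "finite K" "\<And>a. (\<Sum>m\<in>K. c m * monom_val a m) = 0" "m \<in> K"
  shows "c m = 0"
  using assms
proof (induction K arbitrary: c m rule: finite_induct)
  case (insert k K)
  have rel: "(\<Sum>m\<in>K. c m * monom_val a m) + c k * monom_val a k = 0" for a
    using insert.prems(1)[of a] insert.hyps by (simp add: add.commute)
  have K0: "c m = 0" if "m \<in> K" for m
  proof -
    from that insert.hyps have "m \<noteq> k" by auto
    then obtain v where v: "Poly_Mapping.lookup m v \<noteq> Poly_Mapping.lookup k v"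
      by (metis poly_mapping_eqI)
    \<comment> \<open>At this point \<open>monom_val\<close> reads off the exponent of
      \<open>v\<close> as a power of 2, which tells \<open>m\<close> and \<open>k\<close>
      apart.\<close>
    define b :: "'v \<Rightarrow> complex" where "b = (\<lambda>u. if u = v then 2 else 1)"
    have b: "monom_val b n = 2 ^ Poly_Mapping.lookup n v" for n
    proof -
      have "monom_val b n = (\<Prod>u\<in>insert v (Poly_Mapping.keys n). b u ^ Poly_Mapping.lookup n u)"
        by (rule monom_val_superset) auto
      also have "\<dots> = (\<Prod>u\<in>{v}. b u ^ Poly_Mapping.lookup n u)"
        by (rule prod.mono_neutral_right) (auto simp: b_def)
      finally show ?thesis by (simp add: b_def)
    qed
    \<comment> \<open>Multiplying the point by \<open>b\<close> and subtracting
      \<open>monom_val b k\<close> times the original relation cancels the term of \<open>k\<close>,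
      so the induction hypothesis applies.\<close>
    have "(\<Sum>m\<in>K. c m * (monom_val b m - monom_val b k) * monom_val a m) = 0" for a
    proof -
      have "(\<Sum>m\<in>K. c m * (monom_val b m - monom_val b k) * monom_val a m)
          = (\<Sum>m\<in>K. c m * monom_val (\<lambda>v. a v * b v) m) - monom_val b k * (\<Sum>m\<in>K. c m * monom_val a m)"
        by (simp add: monom_val_mult sum_distrib_left sum_subtractf algebra_simps)
      also have "\<dots> = 0"
        using rel[of "\<lambda>v. a v * b v", THEN eq_neg_iff_add_eq_0[THEN iffD2]]
          rel[of a, THEN eq_neg_iff_add_eq_0[THEN iffD2]]
        by (simp only: monom_val_mult) simp
      finally show ?thesis .
    qed
    from insert.IH[OF this that] have "c m * (monom_val b m - monom_val b k) = 0" .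
    moreover have "monom_val b m \<noteq> monom_val b k"
    proof
      assume "monom_val b m = monom_val b k"
      \<comment> \<open>Norms turn the equation into one between real powers of 2, where exponents
        can be compared.\<close>
      then have "norm (monom_val b m) = norm (monom_val b k)" by simp
      with v show False by (simp add: b norm_power)
    qed
    ultimately show ?thesis by simp
  qed
  have "c k * monom_val (\<lambda>_. 1) k = 0"
    using rel[of "\<lambda>_. 1"] K0 by simp
  then have "c k = 0" by (simp add: monom_val_def)
  with K0 insert.prems(2) show ?case by auto
qed simp

text \<open>Monomials are linearly independent as functions on complex points. Points are given by
  constant polynomials, so that evaluation is again a substitution.\<close>

lemma cpoly_eq_0I:
  fixes p :: "'v cpoly"
  assumes "\<And>a. psubst (\<lambda>v. Cst (a v)) p = (0 :: 'w cpoly)"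
  shows "p = 0"
proof (rule poly_mapping_eqI)
  fix m
  have "(\<Sum>m\<in>Poly_Mapping.keys p. Poly_Mapping.lookup p m * monom_val a m) = 0" for a
  proof -
    have Cst_sum: "(\<Sum>m\<in>K. Cst (f m)) = Cst (\<Sum>m\<in>K. f m)" for K and f :: "('v \<Rightarrow>\<^sub>0 nat) \<Rightarrow> complex"
      by (induction K rule: infinite_finite_induct) (simp_all add: Cst_add)
    have "psubst (\<lambda>v. Cst (a v)) p =
        (Cst (\<Sum>m\<in>Poly_Mapping.keys p. Poly_Mapping.lookup p m * monom_val a m) :: 'w cpoly)"
      by (simp add: psubst_superset[of "Poly_Mapping.keys p"] monom_val_Cst Cst_mult[symmetric] Cst_sum)
    then show ?thesis using assms[of a] by simp
  qed
  from monom_val_independent[OF finite_keys this]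
  show "Poly_Mapping.lookup p m = Poly_Mapping.lookup 0 m"
    by (metis in_keys_iff lookup_zero)
qed

subsection \<open>Algebraic independence and linear independence over \<open>R\<close>\<close>

text \<open>Ordering the variables orders the monomials, which makes \<open>xyvar cpoly\<close> an
  instance of an integral domain, as the cancellations in \<open>basis_comb_eq_0D\<close>
  require.\<close>

instantiation xyvar :: linorder
begin

primrec xyvar_index :: "xyvar \<Rightarrow> nat" where
  "xyvar_index X1 = 0" | "xyvar_index X2 = 1" | "xyvar_index Y1 = 2" | "xyvar_index Y2 = 3"

definition "v \<le> w \<longleftrightarrow> xyvar_index v \<le> xyvar_index w"

definition "v < w \<longleftrightarrow> xyvar_index v < xyvar_index w"

instance
proof
  show "v = w" if "v \<le> w" "w \<le> v" for v w :: xyvar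
    using that by (cases v; cases w) (auto simp: less_eq_xyvar_def)
qed (auto simp: less_eq_xyvar_def less_xyvar_def)

end

text \<open>The squares are the two roots of \<open>X^2 - s * X + t\<close>, given by the quadratic
  formula with \<open>d\<close> a square root of the discriminant.\<close>

lemma exists_square_roots:
  "\<exists>u w :: complex. u\<^sup>2 + w\<^sup>2 = s \<and> u\<^sup>2 * w\<^sup>2 = t"
proof -
  obtain d where d: "d\<^sup>2 = s\<^sup>2 - 4 * t"
    using power2_csqrt by blast
  have "(s + d) / 2 + (s - d) / 2 = s"
    by (simp add: field_simps)
  moreover have "(s + d) / 2 * ((s - d) / 2) = (s\<^sup>2 - d\<^sup>2) / 4"
    by (simp add: field_simps power2_eq_square)
  ultimately show ?thesis
    using d by (intro exI[of _ "csqrt ((s + d) / 2)"] exI[of _ "csqrt ((s - d) / 2)"]) simp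
qed

text \<open>By \<open>exists_square_roots\<close>, \<open>S1\<close>, \<open>S2\<close>,
  \<open>T1\<close>, \<open>T2\<close> take every quadruple of complex values simultaneously, so
  \<open>P\<close> vanishes at every point.\<close>

lemma psubst_rval_eq_0D:
  assumes "psubst rval P = 0"
  shows "P = 0"
proof (rule cpoly_eq_0I)
  fix a :: "rvar \<Rightarrow> complex"
  obtain u1 u2 where u: "u1\<^sup>2 + u2\<^sup>2 = a RS1" "u1\<^sup>2 * u2\<^sup>2 = a RS2"
    using exists_square_roots by blast
  obtain w1 w2 where w: "w1\<^sup>2 + w2\<^sup>2 = a RT1" "w1\<^sup>2 * w2\<^sup>2 = a RT2"
    using exists_square_roots by blast
  define pt :: "xyvar \<Rightarrow> xyvar cpoly" where
    "pt = (\<lambda>v. Cst (case v of X1 \<Rightarrow> u1 | X2 \<Rightarrow> u2 | Y1 \<Rightarrow> w1 | Y2 \<Rightarrow> w2))"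
  have "psubst pt (rval v) = Cst (a v)" for v
    by (cases v)
       (simp_all add: S1_def S2_def T1_def T2_def psubst_hom pt_def u[symmetric] w[symmetric]
          Cst_add Cst_mult Cst_power)
  then have "psubst (\<lambda>v. Cst (a v)) P = psubst pt (psubst rval P)"
    by (simp add: psubst_psubst)
  with assms show "psubst (\<lambda>v. Cst (a v)) P = (0 :: xyvar cpoly)"
    by simp
qed

lemma inj_psubst_rval: "inj (psubst rval)"
proof (rule injI)
  fix P Q assume "psubst rval P = psubst rval Q"
  then have "psubst rval (P - Q) = 0" by (simp add: psubst_diff)
  then show "P = Q" using psubst_rval_eq_0D by fastforce
qed

lemma range_rval: "range rval = {S1, T1, S2, T2}"
proof -
  have "UNIV = {RS1, RT1, RS2, RT2}" using rvar.exhaust by auto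
  then show ?thesis by (metis image_empty image_insert rval.simps)
qed

lemma R_alg_eq: "R_alg = range (psubst rval)"
  by (simp add: R_alg_def range_psubst range_rval)

text \<open>This is the normal form with \<open>x1\<close>, \<open>x2\<close>, \<open>y1\<close>,
  \<open>y2\<close> replaced by \<open>a\<close>, \<open>b\<close>, \<open>c\<close>,
  \<open>d\<close> in any ring; sign changes and the exchange of \<open>x1\<close> and
  \<open>x2\<close> become changes of arguments.\<close>

definition basis_comb :: "'a::comm_ring_1 \<Rightarrow> 'a \<Rightarrow> 'a \<Rightarrow> 'a \<Rightarrow> 'a \<Rightarrow> 'a \<Rightarrow> 'a \<Rightarrow> 'a \<Rightarrow> 'a \<Rightarrow> 'a \<Rightarrow> 'a \<Rightarrow> 'a \<Rightarrow> 'a" where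
  "basis_comb p0 p1 p2 p3 p4 q2 q3 q4 a b c d =
     p0 + p1 * (a * c + b * d) + p2 * (a * c + b * d)^2 + p3 * (a * c + b * d)^3
        + p4 * (a * c + b * d)^4 + q2 * (a * c * b * d)
        + q3 * (a * c^3 + b * d^3) + q4 * (a^3 * c + b^3 * d)"

text \<open>The sign changes of \<open>a\<close> and \<open>b\<close> separate the parts of each parity in \<open>a * c\<close> and \<open>b * d\<close>.\<close>

lemma basis_comb_parity_parts:
  fixes a b c d :: "'a::{idom,ring_char_0}"
  assumes "a \<noteq> 0" "b \<noteq> 0" "c \<noteq> 0" "d \<noteq> 0"
    and pp: "basis_comb p0 p1 p2 p3 p4 q2 q3 q4 a b c d = 0"
    and mp: "basis_comb p0 p1 p2 p3 p4 q2 q3 q4 (- a) b c d = 0"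
    and pm: "basis_comb p0 p1 p2 p3 p4 q2 q3 q4 a (- b) c d = 0"
    and mm: "basis_comb p0 p1 p2 p3 p4 q2 q3 q4 (- a) (- b) c d = 0"
  shows "p0 + p2 * (a^2 * c^2 + b^2 * d^2)
           + p4 * (a^4 * c^4 + 6 * a^2 * c^2 * b^2 * d^2 + b^4 * d^4) = 0" (is "?A = 0")
    and "2 * p2 + 4 * p4 * (a^2 * c^2 + b^2 * d^2) + q2 = 0" (is "?B = 0")
    and "p1 + p3 * (a^2 * c^2 + 3 * b^2 * d^2) + q3 * c^2 + q4 * a^2 = 0" (is "?C = 0")
    and "p1 + p3 * (b^2 * d^2 + 3 * a^2 * c^2) + q3 * d^2 + q4 * b^2 = 0" (is "?D = 0")
proof -
  let ?F = "basis_comb p0 p1 p2 p3 p4 q2 q3 q4"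
  \<comment> \<open>Summing against the four characters of the sign group isolates in turn the part
    even in both \<open>a\<close> and \<open>b\<close>, odd in both, odd in \<open>a\<close> only
    and odd in \<open>b\<close> only. The last three carry a nonzero monomial factor that
    cancels.\<close>
  have "4 * ?A = ?F a b c d + ?F (- a) b c d + ?F a (- b) c d + ?F (- a) (- b) c d"
    unfolding basis_comb_def by algebra
  then have "4 * ?A = 0" by (simp only: pp mp pm mm add_0)
  then show "?A = 0" by (metis mult_eq_0_iff zero_neq_numeral)
  have "4 * (a * b * c * d) * ?B = ?F a b c d - ?F (- a) b c d - ?F a (- b) c d + ?F (- a) (- b) c d"
    unfolding basis_comb_def by algebra
  then show "?B = 0" using pp mp pm mm assms(1-4) by simp
  have "4 * (a * c) * ?C = ?F a b c d - ?F (- a) b c d + ?F a (- b) c d - ?F (- a) (- b) c d"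
    unfolding basis_comb_def by algebra
  then show "?C = 0" using pp mp pm mm assms(1-4) by simp
  have "4 * (b * d) * ?D = ?F a b c d + ?F (- a) b c d - ?F a (- b) c d - ?F (- a) (- b) c d"
    unfolding basis_comb_def by algebra
  then show "?D = 0" using pp mp pm mm assms(1-4) by simp
qed

text \<open>Exchanging \<open>a\<close> and \<open>b\<close> yields a second version of each parity
  part with the same coefficients. Combining the versions leaves \<open>p4\<close>, then
  \<open>p2\<close>, then \<open>p3\<close> times \<open>(a^2 - b^2) * (c^2 - d^2)\<close>, up to a
  numerical factor. Each of \<open>q4\<close> and \<open>q3\<close> then meets one of these two
  factors, and \<open>p0\<close>, \<open>q2\<close>, \<open>p1\<close> follow by back
  substitution.\<close>

lemma basis_comb_eq_0D:
  fixes a b c d :: "'a::{idom,ring_char_0}"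
  assumes nz: "a \<noteq> 0" "b \<noteq> 0" "c \<noteq> 0" "d \<noteq> 0" "a^2 \<noteq> b^2" "c^2 \<noteq> d^2"
    and "\<And>u v. (u, v) \<in> {a, - a} \<times> {b, - b} \<union> {b, - b} \<times> {a, - a} \<Longrightarrow>
           basis_comb p0 p1 p2 p3 p4 q2 q3 q4 u v c d = 0"
  shows "p0 = 0 \<and> p1 = 0 \<and> p2 = 0 \<and> p3 = 0 \<and> p4 = 0 \<and> q2 = 0 \<and> q3 = 0 \<and> q4 = 0"
proof -
  note ab = basis_comb_parity_parts[of a b c d p0 p1 p2 p3 p4 q2 q3 q4]
  note ba = basis_comb_parity_parts[of b a c d p0 p1 p2 p3 p4 q2 q3 q4]
  have A: "p0 + p2 * (a^2 * c^2 + b^2 * d^2)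
           + p4 * (a^4 * c^4 + 6 * a^2 * c^2 * b^2 * d^2 + b^4 * d^4) = 0"
    and B: "2 * p2 + 4 * p4 * (a^2 * c^2 + b^2 * d^2) + q2 = 0"
    and C: "p1 + p3 * (a^2 * c^2 + 3 * b^2 * d^2) + q3 * c^2 + q4 * a^2 = 0"
    and D: "p1 + p3 * (b^2 * d^2 + 3 * a^2 * c^2) + q3 * d^2 + q4 * b^2 = 0"
    by (rule ab; use assms in auto)+
  have A': "p0 + p2 * (b^2 * c^2 + a^2 * d^2)
           + p4 * (b^4 * c^4 + 6 * b^2 * c^2 * a^2 * d^2 + a^4 * d^4) = 0"
    and B': "2 * p2 + 4 * p4 * (b^2 * c^2 + a^2 * d^2) + q2 = 0"
    and C': "p1 + p3 * (b^2 * c^2 + 3 * a^2 * d^2) + q3 * c^2 + q4 * b^2 = 0"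
    and D': "p1 + p3 * (a^2 * d^2 + 3 * b^2 * c^2) + q3 * d^2 + q4 * a^2 = 0"
    by (rule ba; use assms in auto)+
  have dnz: "a^2 - b^2 \<noteq> 0" "c^2 - d^2 \<noteq> 0"
    using nz by auto
  have "4 * p4 * ((a^2 - b^2) * (c^2 - d^2)) = 0"
    using B B' by algebra
  then have p4: "p4 = 0" using dnz by simp
  have "p2 * ((a^2 - b^2) * (c^2 - d^2)) = 0"
    using A A' unfolding p4 by algebra
  then have p2: "p2 = 0" using dnz by simp
  have "4 * p3 * ((a^2 - b^2) * (c^2 - d^2)) = 0"
    using C C' D D' by algebra
  then have p3: "p3 = 0" using dnz by simp
  have "q4 * (a^2 - b^2) = 0" "q3 * (c^2 - d^2) = 0"
    using C C' D D' unfolding p3 by algebra+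
  then have "q4 = 0" "q3 = 0" using dnz by simp_all
  with p2 p3 p4 A B C show ?thesis by simp
qed

lemma xy_distinct:
  "x1 \<noteq> 0" "x2 \<noteq> 0" "y1 \<noteq> 0" "y2 \<noteq> 0" "x1^2 \<noteq> x2^2" "y1^2 \<noteq> y2^2"
proof -
  have V: "Var v \<noteq> (0 :: xyvar cpoly)" for v
    using psubst_Var[of "\<lambda>_. 1 :: xyvar cpoly" v] by (metis psubst_0 zero_neq_one)
  then show "x1 \<noteq> 0" "x2 \<noteq> 0" "y1 \<noteq> 0" "y2 \<noteq> 0" by auto
  have "Var v ^ 2 \<noteq> (Var w ^ 2 :: xyvar cpoly)" if "v \<noteq> w" for v w
  proof
    assume "Var v ^ 2 = (Var w ^ 2 :: xyvar cpoly)"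
    from arg_cong[OF this, of "psubst (\<lambda>u. if u = v then 1 else 0 :: xyvar cpoly)"] that
    show False by (simp add: psubst_power)
  qed
  then show "x1^2 \<noteq> x2^2" "y1^2 \<noteq> y2^2" by auto
qed

text \<open>\<open>S1\<close> and \<open>S2\<close> are symmetric in the squares of
  \<open>x1\<close> and \<open>x2\<close> alone, so all eight signed permutations of
  \<open>x1\<close>, \<open>x2\<close> with \<open>y1\<close>, \<open>y2\<close> held fixed act
  trivially on the coefficients. Applied to the relation, they give the hypotheses of
  \<open>basis_comb_eq_0D\<close>.\<close>

lemma R_basis_independent:
  assumes R: "{P0, P1, P2, P3, P4, Q2, Q3, Q4} \<subseteq> R_alg"
    and eq: "P0 + P1 * Z1 + P2 * Z1^2 + P3 * Z1^3 + P4 * Z1^4 + Q2 * Z2 + Q3 * Z3 + Q4 * Z4 = 0"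
  shows "P0 = 0 \<and> P1 = 0 \<and> P2 = 0 \<and> P3 = 0 \<and> P4 = 0 \<and> Q2 = 0 \<and> Q3 = 0 \<and> Q4 = 0"
proof (rule basis_comb_eq_0D[OF xy_distinct])
  fix u v assume uv: "(u, v) \<in> {x1, - x1} \<times> {x2, - x2} \<union> {x2, - x2} \<times> {x1, - x1}"
  define h where "h = Var(X1 := u, X2 := v)"
  have "psubst h (rval w) = rval w" for w
    using uv by (cases w) (auto simp: h_def S1_def S2_def T1_def T2_def psubst_hom)
  then have fix_R: "psubst h P = P" if "P \<in> R_alg" for P
    using that by (auto simp: R_alg_eq psubst_psubst)
  have "h X1 = u" "h X2 = v" "h Y1 = y1" "h Y2 = y2"
    by (simp_all add: h_def)
  then show "basis_comb P0 P1 P2 P3 P4 Q2 Q3 Q4 u v y1 y2 = 0"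
    using arg_cong[OF eq, of "psubst h"] R
    by (simp add: psubst_hom fix_R Z1_def Z2_def Z3_def Z4_def basis_comb_def)
qed

subsection \<open>Rewriting modulo the relations\<close>

interpretation self_module: module "(*) :: 'a \<Rightarrow> 'a \<Rightarrow> 'a::comm_ring_1"
  by (rule module_mult)

text \<open>The relations are affine in \<open>q\<close>, which stands for \<open>1/4\<close>; hence the value of
  a relation is \<open>1 - 4 * q\<close> times its value at \<open>q = 0\<close>.\<close>

lemma gval_relations:
  assumes "r \<in> relations"
  shows "psubst gval r = 0"
proof -
  define q :: "xyvar cpoly" where "q = Cst (1/4)"
  have q: "1 - 4 * q = 0"
    using Cst_mult[of 4 "1/4"] by (simp add: q_def)
  have C: "Cst (1/4) = q" "Cst (1/2) = 2 * q" "Cst (3/2) = 6 * q" "Cst (5/4) = 5 * q"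
    using Cst_mult[of 2 "1/4"] Cst_mult[of 6 "1/4"] Cst_mult[of 5 "1/4"] by (simp_all add: q_def)
  note defs = S1_def S2_def T1_def T2_def Z1_def Z2_def Z3_def Z4_def
  have r1: "Z1^5 - ((16 * S2 * T2 - 5 * S2 * T1^2 - 5 * S1^2 * T2 + 2 * q * S1^2 * T1^2) * Z1
      + 6 * q * S1 * T1 * Z1^3 + (4 * S2 * T1 - 2 * q * S1^2 * T1) * Z3
      + (4 * S1 * T2 - 2 * q * S1 * T1^2) * Z4)
    = (1 - 4 * q) * (Z1^5 - ((16 * S2 * T2 - 5 * S2 * T1^2 - 5 * S1^2 * T2) * Z1
      + 4 * S2 * T1 * Z3 + 4 * S1 * T2 * Z4))"
    unfolding defs by algebra
  have r2: "Z1 * Z2 - (q * S1 * T1 * Z1 + q * Z1^3 - q * S1 * Z3 - q * T1 * Z4)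
    = (1 - 4 * q) * (Z1 * Z2)"
    unfolding defs by algebra
  have r6: "Z2 * Z3 - ((q * S1 * T1^2 - S1 * T2) * Z1 + q * T1 * Z1^3 - q * S1 * T1 * Z3
      + (T2 - q * T1^2) * Z4)
    = (1 - 4 * q) * (Z2 * Z3 + S1 * T2 * Z1 - T2 * Z4)"
    unfolding defs by algebra
  have r7: "Z2 * Z4 - ((q * S1^2 * T1 - S2 * T1) * Z1 + q * S1 * Z1^3
      + (S2 - q * S1^2) * Z3 - q * S1 * T1 * Z4)
    = (1 - 4 * q) * (Z2 * Z4 + S2 * T1 * Z1 - S2 * Z3)"
    unfolding defs by algebra
  have r9: "Z3 * Z4 - (4 * S2 * T2 - 5 * q * S2 * T1^2 - 5 * q * S1^2 * T2
      + 5 * q * S1 * T1 * Z1^2 - q * Z1^4 - 6 * q * S1 * T1 * Z2)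
    = (1 - 4 * q) * (Z3 * Z4 - 4 * S2 * T2)"
    unfolding defs by algebra
  \<comment> \<open>The other five relations have integer coefficients and are identities in
    \<open>x1\<close>, \<open>x2\<close>, \<open>y1\<close>, \<open>y2\<close>.\<close>
  have r: "Z1 * Z3 - (- (S1 * T2) + T1 * Z1^2 - T1 * Z2) = 0"
    "Z1 * Z4 - (- (S2 * T1) + S1 * Z1^2 - S1 * Z2) = 0"
    "Z2^2 - S2 * T2 = 0"
    "Z3^2 - (- (S1 * T1 * T2) + (T1^2 - T2) * Z1^2 + (4 * T2 - 2 * T1^2) * Z2) = 0"
    "Z4^2 - (- (S1 * S2 * T1) + (S1^2 - S2) * Z1^2 + (4 * S2 - 2 * S1^2) * Z2) = 0"
    unfolding defs by algebra+
  show ?thesis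
    using assms unfolding relations_def Let_def insert_iff empty_iff
    by (elim disjE FalseE; simp only: psubst_hom psubst_Var psubst_Cst psubst_numeral gval.simps C
        r1 r2 r6 r7 r9 r q mult_zero_left)
qed

lemma ideal_relations_subset_kernel: "ideal_gen relations \<subseteq> {p. psubst gval p = 0}"
  by (rule self_module.span_minimal)
     (auto simp: gval_relations self_module.subspace_def psubst_hom)

section \<open>The free algebra as a module over a copy of R, modulo the relations\<close>

fun rgen :: "rvar \<Rightarrow> gvar cpoly" where
  "rgen RS1 = Var GS1" | "rgen RT1 = Var GT1" | "rgen RS2 = Var GS2" | "rgen RT2 = Var GT2"

text \<open>This copy of R inside the free algebra is mapped onto \<open>R_alg\<close> by
  \<open>psubst gval\<close>.\<close>

definition R_free :: "gvar cpoly set" where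
  "R_free = range (psubst rgen)"

lemma subalgebra_R_free: "subalgebra R_free"
  by (simp add: R_free_def subalgebra_range_psubst)

lemma Var_in_R_free: "Var GS1 \<in> R_free" "Var GT1 \<in> R_free" "Var GS2 \<in> R_free" "Var GT2 \<in> R_free"
  unfolding R_free_def
  by (metis psubst_Var rangeI rgen.simps)+

lemma psubst_gval_rgen: "psubst gval (psubst rgen P) = psubst rval P"
proof -
  have "psubst gval (rgen v) = rval v" for v by (cases v) simp_all
  then show ?thesis by (simp add: psubst_psubst)
qed

definition free_basis :: "gvar cpoly list" where
  "free_basis = [1, Var GZ1, Var GZ1^2, Var GZ1^3, Var GZ1^4, Var GZ2, Var GZ3, Var GZ4]"

lemma length_free_basis: "length free_basis = 8"
  by (simp add: free_basis_def)

text \<open>The \<open>R_free\<close>-submodule spanned by the relation ideal and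
  \<open>free_basis\<close>; it turns out to be the whole free algebra.\<close>

inductive_set reducible :: "gvar cpoly set" where
  ideal: "i \<in> ideal_gen relations \<Longrightarrow> i \<in> reducible"
| basis: "e \<in> R_free \<Longrightarrow> b \<in> set free_basis \<Longrightarrow> e * b \<in> reducible"
| add: "p \<in> reducible \<Longrightarrow> q \<in> reducible \<Longrightarrow> p + q \<in> reducible"

text \<open>Ideal parts and coefficient vectors add separately, so an arbitrary sum collapses to one
  coefficient per basis element.\<close>

lemma reducible_normal_form:
  assumes "p \<in> reducible"
  shows "\<exists>i\<in>ideal_gen relations. \<exists>c. range c \<subseteq> R_free \<and> p = i + (\<Sum>k<8. c k * free_basis ! k)"
proof -
  have R0: "0 \<in> R_free"
    using subalgebra_Cst[OF subalgebra_R_free, of 0] by simp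
  from assms show ?thesis
  proof induction
    case (ideal i)
    then show ?case
      using R0 by (intro bexI[of _ i] exI[of _ "\<lambda>_. 0"]) auto
  next
    case (basis e b)
    then obtain j where j: "j < 8" "b = free_basis ! j"
      by (metis in_set_conv_nth length_free_basis)
    have "(\<Sum>k<8. (if k = j then e else 0) * free_basis ! k) = e * b"
      using j by (simp add: if_distrib[of "\<lambda>t. t * _"] cong: if_cong)
    then show ?case
      using R0 basis(1) self_module.span_zero
      by (intro bexI[of _ 0] exI[of _ "\<lambda>k. if k = j then e else 0"]) auto
  next
    case (add p q)
    then obtain i c j d where "i \<in> ideal_gen relations" "j \<in> ideal_gen relations"
      "range c \<subseteq> R_free" "range d \<subseteq> R_free"
      "p = i + (\<Sum>k<8. c k * free_basis ! k)" "q = j + (\<Sum>k<8. d k * free_basis ! k)"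
      by blast
    then show ?case
      by (intro bexI[of _ "i + j"] exI[of _ "\<lambda>k. c k + d k"])
         (auto simp: sum.distrib distrib_right self_module.span_add image_subset_iff
            intro: subalgebra_add[OF subalgebra_R_free])
  qed
qed

lemma reducible_scale: "p \<in> reducible \<Longrightarrow> e \<in> R_free \<Longrightarrow> e * p \<in> reducible"
proof (induction rule: reducible.induct)
  case (ideal i)
  then show ?case by (intro reducible.ideal self_module.span_scale)
next
  case (basis e' b)
  then show ?case
    using reducible.basis[OF subalgebra_mult[OF subalgebra_R_free, of e e'], of b]
    by (simp only: mult.assoc)
next
  case (add p q)
  then show ?case by (simp add: distrib_left reducible.add)
qed

lemma reducible_R_free: "e \<in> R_free \<Longrightarrow> e \<in> reducible"
  using reducible.basis[of e 1] by (simp add: free_basis_def)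

lemma reducible_free_basis: "b \<in> set free_basis \<Longrightarrow> b \<in> reducible"
  using reducible.basis[of 1 b] subalgebra_Cst[OF subalgebra_R_free, of 1] by simp

lemma reducible_uminus: "p \<in> reducible \<Longrightarrow> - p \<in> reducible"
  using reducible_scale[of p "Cst (- 1)", OF _ subalgebra_Cst[OF subalgebra_R_free]]
  by (simp add: Cst_minus)

lemma reducible_diff: "p \<in> reducible \<Longrightarrow> q \<in> reducible \<Longrightarrow> p - q \<in> reducible"
  using reducible.add[of p "- q"] reducible_uminus[of q] by simp

text \<open>This lets a relation act as a rewrite rule from left to right.\<close>

lemma reducible_relation: "l - r \<in> relations \<Longrightarrow> r \<in> reducible \<Longrightarrow> l \<in> reducible"
  using reducible.add[of "l - r" r] reducible.ideal[OF self_module.span_base, of "l - r"] by simp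

text \<open>Together with the powers of \<open>z1\<close> in \<open>free_basis\<close>, these cover
  all products of two of the \<open>z\<close> variables, and \<open>z1^5\<close> stops the powers of
  \<open>z1\<close>.\<close>

lemma reducible_products:
  defines "z1 \<equiv> Var GZ1" and "z2 \<equiv> Var GZ2" and "z3 \<equiv> Var GZ3" and "z4 \<equiv> Var GZ4"
  shows "z1^5 \<in> reducible" "z1 * z2 \<in> reducible" "z1 * z3 \<in> reducible" "z1 * z4 \<in> reducible"
    "z2^2 \<in> reducible" "z2 * z3 \<in> reducible" "z2 * z4 \<in> reducible"
    "z3^2 \<in> reducible" "z3 * z4 \<in> reducible" "z4^2 \<in> reducible"
proof -
  note R_intros = Var_in_R_free subalgebra_R_free subalgebra_Cst subalgebra_numeral
    subalgebra_add subalgebra_diff subalgebra_uminus subalgebra_mult subalgebra_power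
  note red_intros = reducible.add reducible_diff reducible_uminus reducible_scale
  have base: "b \<in> reducible" if "b \<in> set free_basis \<union> R_free" for b
    using that reducible_R_free reducible_free_basis by auto
  have B: "z1 \<in> set free_basis" "z1^2 \<in> set free_basis" "z1^3 \<in> set free_basis" "z1^4 \<in> set free_basis"
    "z2 \<in> set free_basis" "z3 \<in> set free_basis" "z4 \<in> set free_basis"
    by (simp_all add: free_basis_def z1_def z2_def z3_def z4_def)
  \<comment> \<open>Each right-hand side is a combination of \<open>free_basis\<close> over \<open>R_free\<close>.\<close>
  show "z1^5 \<in> reducible" "z1 * z2 \<in> reducible" "z1 * z3 \<in> reducible" "z1 * z4 \<in> reducible"
    "z2^2 \<in> reducible" "z2 * z3 \<in> reducible" "z2 * z4 \<in> reducible"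
    "z3^2 \<in> reducible" "z3 * z4 \<in> reducible" "z4^2 \<in> reducible"
    by (rule reducible_relation,
        (simp only: relations_def Let_def z1_def z2_def z3_def z4_def, (rule insertI1 | rule insertI2)+),
        (intro red_intros; (rule base, use B in \<open>simp add: z1_def z2_def z3_def z4_def R_intros\<close> | simp add: R_intros)))+
qed


text \<open>Separating scaling from the basis elements leaves multiplicative claims to be checked on
  \<open>free_basis\<close> itself.\<close>

lemma reducible_induct [consumes 1, case_names ideal basis scale add]:
  assumes "p \<in> reducible"
    and "\<And>i. i \<in> ideal_gen relations \<Longrightarrow> P i" "\<And>b. b \<in> set free_basis \<Longrightarrow> P b"
    and "\<And>e p. e \<in> R_free \<Longrightarrow> P p \<Longrightarrow> P (e * p)" "\<And>p q. P p \<Longrightarrow> P q \<Longrightarrow> P (p + q)"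
  shows "P p"
  using assms(1) by induction (auto intro: assms(2-5))

text \<open>Multiplication by \<open>w\<close> is \<open>R_free\<close>-linear and preserves the
  ideal, so its effect on \<open>free_basis\<close> decides.\<close>

lemma reducible_mult_by:
  assumes "\<And>b. b \<in> set free_basis \<Longrightarrow> w * b \<in> reducible" "p \<in> reducible"
  shows "w * p \<in> reducible"
  using assms(2)
proof (induction rule: reducible_induct)
  case (ideal i)
  then show ?case by (intro reducible.ideal self_module.span_scale)
next
  case (scale e p)
  then show ?case using reducible_scale[of "w * p" e] by (simp only: mult.left_commute[of w])
next
  case (add p q)
  then show ?case unfolding distrib_left by (rule reducible.add)
qed (rule assms(1))

lemma reducible_mult_Var:
  assumes "p \<in> reducible"
  shows "Var v * p \<in> reducible"
proof -
  let ?z1 = "Var GZ1" and ?z2 = "Var GZ2" and ?z3 = "Var GZ3" and ?z4 = "Var GZ4"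
  have base: "b \<in> reducible" if "b \<in> {?z1, ?z1^2, ?z1^3, ?z1^4, ?z2, ?z3, ?z4}" for b
    using that reducible_free_basis[of b] by (auto simp: free_basis_def)
  have z1: "?z1 * q \<in> reducible" if "q \<in> reducible" for q
  proof (rule reducible_mult_by[OF _ that])
    fix b assume "b \<in> set free_basis"
    moreover have "?z1 * ?z1 = ?z1^2" "?z1 * ?z1^2 = ?z1^3" "?z1 * ?z1^3 = ?z1^4" "?z1 * ?z1^4 = ?z1^5"
      by (simp_all add: eval_nat_numeral)
    moreover have "?z1 \<in> reducible" "?z1^2 \<in> reducible" "?z1^3 \<in> reducible" "?z1^4 \<in> reducible"
      by (rule base, simp)+
    ultimately show "?z1 * b \<in> reducible"
      using reducible_products(1-4) unfolding free_basis_def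
      by (auto simp only: set_simps insert_iff empty_iff mult_1_right)
  qed
  \<comment> \<open>The remaining \<open>z\<close> variables are treated uniformly, building on
    stability under \<open>?z1\<close>.\<close>
  have z: "w * q \<in> reducible"
    if q: "q \<in> reducible" and w: "w \<in> reducible" "?z1 * w \<in> reducible" "w * ?z2 \<in> reducible"
      "w * ?z3 \<in> reducible" "w * ?z4 \<in> reducible" for w q
  proof (rule reducible_mult_by[OF _ q])
    \<comment> \<open>The product arises from \<open>w\<close> by \<open>n\<close> multiplications
      by \<open>?z1\<close>, so no further relation is consulted.\<close>
    have pow: "w * ?z1^n \<in> reducible" for n
    proof (induction n)
      case (Suc n)
      from z1[OF this] show ?case by (simp only: power_Suc mult.left_commute)
    qed (use w in simp)
    fix b assume "b \<in> set free_basis"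
    then show "w * b \<in> reducible"
      using w pow[of 0] pow[of 1] pow[of 2] pow[of 3] pow[of 4] unfolding free_basis_def
      by (auto simp only: set_simps insert_iff empty_iff power_0 power_one_right)
  qed
  have "?z2 * p \<in> reducible" "?z3 * p \<in> reducible" "?z4 * p \<in> reducible"
    by (rule z[OF assms]; use reducible_products base in \<open>simp add: power2_eq_square mult.commute\<close>)+
  then show ?thesis
    using z1[OF assms] reducible_scale[OF assms] Var_in_R_free by (cases v) simp_all
qed

text \<open>The multipliers that preserve \<open>reducible\<close> form a subalgebra containing
  every variable, hence everything; multiplying 1 gives the claim.\<close>

lemma reducible_UNIV: "p \<in> reducible"
proof -
  have one: "1 \<in> reducible"
    using reducible_free_basis[of 1] by (simp add: free_basis_def)
  have "subalgebra {w. \<forall>q\<in>reducible. w * q \<in> reducible}" (is "subalgebra ?A")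
    unfolding subalgebra_def
  proof (intro conjI ballI subsetI)
    show "f \<in> ?A" if "f \<in> range Cst" for f
      using that reducible_scale[OF _ subalgebra_Cst[OF subalgebra_R_free]] by blast
    fix f g assume f: "f \<in> ?A" and g: "g \<in> ?A"
    show "f + g \<in> ?A"
      using f g unfolding mem_Collect_eq distrib_right by (blast intro: reducible.add)
    show "f * g \<in> ?A"
      using f g unfolding mem_Collect_eq mult.assoc by blast
  qed
  then have "psubst Var p \<in> ?A"
    by (rule psubst_in_subalgebra) (simp add: reducible_mult_Var)
  then have "p * 1 \<in> reducible"
    using one unfolding psubst_Var_id by blast
  then show ?thesis by simp
qed

subsection \<open>Invariants\<close>

lemma act_hom:
  "act g (p + q) = act g p + act g q" "act g (p * q) = act g p * act g q"
  "act g (p ^ n) = act g p ^ n" "act g (Cst c) = Cst c" "act g (Var v) = act_var g v"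
  by (simp_all add: act_def psubst_hom)

lemma B2_carrier_eq:
  "carrier B2 = {(1, 1, False), (- 1, 1, False), (1, - 1, False), (- 1, - 1, False),
     (1, 1, True), (- 1, 1, True), (1, - 1, True), (- 1, - 1, True)}"
  by (auto simp: B2_def)

lemma subalgebra_invariants: "subalgebra invariants"
  by (auto simp: subalgebra_def invariants_def act_hom)

text \<open>Each monomial of a generator has even total degree in \<open>x1\<close>,
  \<open>y1\<close> and in \<open>x2\<close>, \<open>y2\<close>, so signs occur only squared;
  exchanging the indices permutes its monomials.\<close>

lemma generators_invariant: "gval v \<in> invariants"
proof -
  have "act (e, e', s) (gval v) = gval v" if "e \<in> {1, - 1}" "e' \<in> {1, - 1}" for e e' s
  proof -
    have sq: "Cst e ^ 2 = (1 :: xyvar cpoly)" "Cst e' ^ 2 = (1 :: xyvar cpoly)"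
      using that by (auto simp: Cst_minus)
    have "act (e, e', False) (gval v) = gval v" "act (e, e', True) (gval v) = gval v"
      by (induct v; simp only: gval.simps S1_def S2_def T1_def T2_def Z1_def Z2_def Z3_def Z4_def
            act_hom act_var.simps; use sq in algebra)+
    then show ?thesis by (cases s) simp_all
  qed
  then show ?thesis by (auto simp: invariants_def B2_def)
qed

lemma range_gval: "range gval = {S1, S2, T1, T2, Z1, Z2, Z3, Z4}"
proof -
  have UNIV_gvar: "UNIV = {GS1, GS2, GT1, GT2, GZ1, GZ2, GZ3, GZ4}"
    using gvar.exhaust by auto
  show ?thesis
    unfolding UNIV_gvar by simp
qed

section \<open>Polarized power sums as polynomials in the generators\<close>

definition psum :: "nat \<Rightarrow> nat \<Rightarrow> xyvar cpoly" where
  "psum a b = x1^a * y1^b + x2^a * y2^b"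

text \<open>The squares of \<open>x1\<close>, \<open>x2\<close> are the roots of
  \<open>X^2 - S1 * X + S2\<close>, and those of \<open>y1\<close>, \<open>y2\<close> the roots of
  \<open>X^2 - T1 * X + T2\<close>.\<close>

lemma psum_reduce_x: "psum (a + 4) b = S1 * psum (a + 2) b - S2 * psum a b"
  and psum_reduce_y: "psum a (b + 4) = T1 * psum a (b + 2) - T2 * psum a b"
  unfolding psum_def S1_def S2_def T1_def T2_def power_add by algebra+

text \<open>The recurrences lower one exponent by 2 or 4 and keep the parity of
  \<open>a + b\<close>. Eight pairs with both exponents below 4 remain.\<close>

lemma psum_in_subalgebra:
  assumes A: "subalgebra A" "range gval \<subseteq> A" and "even (a + b)"
  shows "psum a b \<in> A"
  using assms(3)
proof (induction "a + b" arbitrary: a b rule: less_induct)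
  case less
  have G: "S1 \<in> A" "S2 \<in> A" "T1 \<in> A" "T2 \<in> A" "Z1 \<in> A" "Z2 \<in> A" "Z3 \<in> A" "Z4 \<in> A"
    using A(2) by (auto simp: range_gval)
  note closed = subalgebra_add subalgebra_diff subalgebra_mult subalgebra_power
    subalgebra_numeral A(1) G
  consider "a \<ge> 4" | "b \<ge> 4" | "a < 4" "b < 4" by linarith
  then show ?case
  proof cases
    case 1
    then obtain a' where a: "a = a' + 4" by (metis add.commute le_Suc_ex)
    have "psum (a' + 2) b \<in> A" "psum a' b \<in> A"
      using less by (auto simp: a)
    then show ?thesis unfolding a psum_reduce_x by (intro closed)
  next
    case 2
    then obtain b' where b: "b = b' + 4" by (metis add.commute le_Suc_ex)
    have "psum a (b' + 2) \<in> A" "psum a b' \<in> A"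
      using less by (auto simp: b)
    then show ?thesis unfolding b psum_reduce_y by (intro closed)
  next
    case 3
    have "psum 0 0 = 2" "psum 1 1 = Z1" "psum 2 0 = S1" "psum 0 2 = T1" "psum 3 1 = Z4" "psum 1 3 = Z3"
      by (simp_all add: psum_def S1_def T1_def Z1_def Z3_def Z4_def)
    \<comment> \<open>Newton's identities for \<open>x1 * y1\<close> and \<open>x2 * y2\<close>,
      whose elementary symmetric functions are \<open>Z1\<close> and \<open>Z2\<close>.\<close>
    moreover have "psum 2 2 = Z1^2 - 2 * Z2" "psum 3 3 = Z1^3 - 3 * (Z1 * Z2)"
      unfolding psum_def Z1_def Z2_def by algebra+
    ultimately have "psum 0 0 \<in> A" "psum 1 1 \<in> A" "psum 2 0 \<in> A" "psum 0 2 \<in> A" "psum 3 1 \<in> A"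
      "psum 1 3 \<in> A" "psum 2 2 \<in> A" "psum 3 3 \<in> A"
      by (simp_all only:) (intro closed)+
    moreover have "(a, b) \<in> {(0, 0), (1, 1), (2, 0), (0, 2), (3, 1), (1, 3), (2, 2), (3, 3)}"
    proof -
      have "a \<in> {0, 1, 2, 3}" "b \<in> {0, 1, 2, 3}" using 3 by auto
      then show ?thesis using less.prems by auto
    qed
    ultimately show ?thesis by auto
  qed
qed

section \<open>Averaging: the orbit sum is eight times the Reynolds operator\<close>

definition orbit_sum :: "xyvar cpoly \<Rightarrow> xyvar cpoly" where
  "orbit_sum p = (\<Sum>g\<in>carrier B2. act g p)"

lemma orbit_sum_expand:
  "orbit_sum p = act (1, 1, False) p + (act (- 1, 1, False) p + (act (1, - 1, False) p
     + (act (- 1, - 1, False) p + (act (1, 1, True) p + (act (- 1, 1, True) p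
     + (act (1, - 1, True) p + act (- 1, - 1, True) p))))))"
  by (simp add: orbit_sum_def B2_carrier_eq)

text \<open>The sum over signs factors over the two indices and vanishes unless each index has even
  degree. The remaining sum over the exchange of indices is polarized into power sums.\<close>

lemma orbit_sum_monomial:
  "orbit_sum (x1^a * x2^b * y1^c * y2^d) =
     (if even (a + c) \<and> even (b + d) then 4 * (psum a c * psum b d - psum (a + b) (c + d)) else 0)"
proof -
  have act_neg: "(Cst (- 1) * w) ^ n = (- 1) ^ n * w ^ n" for w :: "xyvar cpoly" and n
    by (simp only: power_mult_distrib Cst_minus Cst_1)
  \<comment> \<open>The Greek letters stand for the powers of -1 with exponents \<open>a\<close>,
    \<open>b\<close>, \<open>c\<close>, \<open>d\<close>; primed letters are the powers after
    exchanging the indices.\<close>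
  have factor: "p * q * r * s + (\<alpha> * p * q * (\<gamma> * r) * s + (p * (\<beta> * q) * r * (\<delta> * s)
      + (\<alpha> * p * (\<beta> * q) * (\<gamma> * r) * (\<delta> * s) + (p' * q' * r' * s'
      + (p' * (\<beta> * q') * r' * (\<delta> * s') + (\<alpha> * p' * q' * (\<gamma> * r') * s'
      + \<alpha> * p' * (\<beta> * q') * (\<gamma> * r') * (\<delta> * s')))))))
    = (1 + \<alpha> * \<gamma>) * (1 + \<beta> * \<delta>) * (p * q * r * s + p' * q' * r' * s')"
    for \<alpha> \<beta> \<gamma> \<delta> p q r s p' q' r' s' :: "xyvar cpoly"
    by algebra
  have polarize: "p * q * r * s + p' * q' * r' * s'
    = (p * r + p' * r') * (q' * s' + q * s) - (p * q' * (r * s') + p' * q * (r' * s))"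
    for p q r s p' q' r' s' :: "xyvar cpoly"
    by algebra
  have "orbit_sum (x1^a * x2^b * y1^c * y2^d) = (1 + (- 1)^a * (- 1)^c) * (1 + (- 1)^b * (- 1)^d)
      * (x1^a * x2^b * y1^c * y2^d + x2^a * x1^b * y2^c * y1^d)"
    unfolding orbit_sum_expand act_hom act_var.simps act_neg Cst_1 mult_1_left by (rule factor)
  also have "x1^a * x2^b * y1^c * y2^d + x2^a * x1^b * y2^c * y1^d
      = psum a c * psum b d - psum (a + b) (c + d)"
    unfolding psum_def power_add by (rule polarize)
  finally show ?thesis
    unfolding power_add[symmetric] by (cases "even (a + c)"; cases "even (b + d)") simp_all
qed

lemma monom_val_xyvar:
  "monom_val Var m = x1 ^ Poly_Mapping.lookup m X1 * x2 ^ Poly_Mapping.lookup m X2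
     * y1 ^ Poly_Mapping.lookup m Y1 * y2 ^ Poly_Mapping.lookup m Y2"
proof -
  have "Poly_Mapping.keys m \<subseteq> {X1, X2, Y1, Y2}" using xyvar.exhaust by auto
  then have "monom_val Var m = (\<Prod>v\<in>{X1, X2, Y1, Y2}. Var v ^ Poly_Mapping.lookup m v)"
    by (intro monom_val_superset) simp_all
  also have "\<dots> = x1 ^ Poly_Mapping.lookup m X1 * (x2 ^ Poly_Mapping.lookup m X2
     * (y1 ^ Poly_Mapping.lookup m Y1 * y2 ^ Poly_Mapping.lookup m Y2))"
    by simp
  finally show ?thesis
    by (simp only: mult.assoc)
qed

text \<open>Linearity reduces this to monomials, whose orbit sums are zero or polynomials in power
  sums of even total degree.\<close>

lemma orbit_sum_in_subalgebra:
  assumes A: "subalgebra A" "range gval \<subseteq> A"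
  shows "orbit_sum p \<in> A"
proof (induction p rule: cpoly_induct)
  case (single m c)
  have "orbit_sum (x1^i * x2^j * y1^k * y2^l) \<in> A" for i j k l
  proof (cases "even (i + k) \<and> even (j + l)")
    case True
    then have "even ((i + j) + (k + l))" by auto
    with True A show ?thesis
      by (simp add: orbit_sum_monomial subalgebra_mult subalgebra_diff psum_in_subalgebra
            subalgebra_numeral)
  next
    case False
    then show ?thesis using subalgebra_Cst[OF A(1), of 0] by (auto simp: orbit_sum_monomial)
  qed
  moreover have "orbit_sum (Cst c * p) = Cst c * orbit_sum p" for p
    by (simp add: orbit_sum_def act_hom sum_distrib_left)
  ultimately show ?case
    by (simp only: single_eq_monom_val monom_val_xyvar A subalgebra_mult subalgebra_Cst)
next
  case (add p q)
  moreover have "orbit_sum (p + q) = orbit_sum p + orbit_sum q"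
    by (simp add: orbit_sum_def act_hom sum.distrib)
  ultimately show ?case by (simp add: A subalgebra_add)
qed

text \<open>The group has order 8, so an invariant is one eighth of its orbit sum and lies in the
  subalgebra of the generators.\<close>

lemma invariants_eq: "invariants = subalgebra_gen (range gval)"
proof
  show "subalgebra_gen (range gval) \<subseteq> invariants"
    by (rule hull_minimal) (use generators_invariant subalgebra_invariants in auto)
  let ?A = "subalgebra_gen (range gval)"
  show "invariants \<subseteq> ?A"
  proof
    fix p assume p: "p \<in> invariants"
    have "orbit_sum p = 8 * p"
      using p by (simp add: orbit_sum_expand invariants_def B2_carrier_eq)
    moreover have "Cst (1/8) * 8 = (1 :: xyvar cpoly)"
      using Cst_mult[of "1/8" 8] by simp
    ultimately have "p = Cst (1/8) * orbit_sum p"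
      by (simp only: mult.assoc[symmetric] mult_1_left)
    moreover have "Cst (1/8) * orbit_sum p \<in> ?A"
      by (intro subalgebra_mult subalgebra_hull subalgebra_Cst orbit_sum_in_subalgebra hull_subset)
    ultimately show "p \<in> ?A" by metis
  qed
qed

theorem mainTheorem5:
  shows
    "invariants = subalgebra_gen {S1, S2, T1, T2, Z1, Z2, Z3, Z4}
     \<and>
     bij_betw (psubst rval) UNIV R_alg
     \<and>
     (\<forall>Q\<in>invariants.
       \<exists>!(P0, P1, P2, P3, P4, Q2, Q3, Q4) \<in>
           R_alg \<times> R_alg \<times> R_alg \<times> R_alg \<times> R_alg \<times> R_alg \<times> R_alg \<times> R_alg.
         Q = P0 + P1 * Z1 + P2 * Z1^2 + P3 * Z1^3 + P4 * Z1^4 + Q2 * Z2 + Q3 * Z3 + Q4 * Z4)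
     \<and>
     is_presentation gval relations invariants"
proof (intro conjI ballI)
  show "invariants = subalgebra_gen {S1, S2, T1, T2, Z1, Z2, Z3, Z4}"
    by (simp add: invariants_eq range_gval)
  show "bij_betw (psubst rval) UNIV R_alg"
    by (simp add: bij_betw_def inj_psubst_rval R_alg_eq)
  \<comment> \<open>Coefficients are lifted to formal polynomials in four variables, to which
    injectivity of \<open>psubst rval\<close> applies.\<close>
  have normal_form: "\<exists>i\<in>ideal_gen relations. \<exists>c. p = i + (\<Sum>k<8. psubst rgen (c k) * free_basis ! k)" for p
  proof -
    obtain i c where ic: "i \<in> ideal_gen relations" "range c \<subseteq> R_free"
      "p = i + (\<Sum>k<8. c k * free_basis ! k)"
      using reducible_normal_form[OF reducible_UNIV] by blast
    from ic(2) have "\<forall>k. \<exists>d. c k = psubst rgen d" by (auto simp: R_free_def)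
    then obtain d where "\<And>k. c k = psubst rgen (d k)" by metis
    with ic show ?thesis by auto
  qed
  have ideal_0: "psubst gval i = 0" if "i \<in> ideal_gen relations" for i
    using that ideal_relations_subset_kernel by auto
  have image: "psubst gval (\<Sum>k<8. psubst rgen (c k) * free_basis ! k) =
      psubst rval (c 0) + psubst rval (c 1) * Z1 + psubst rval (c 2) * Z1^2 + psubst rval (c 3) * Z1^3
      + psubst rval (c 4) * Z1^4 + psubst rval (c 5) * Z2 + psubst rval (c 6) * Z3
      + psubst rval (c 7) * Z4" for c
    by (simp add: eval_nat_numeral lessThan_Suc free_basis_def psubst_hom psubst_gval_rgen
          del: power_Suc)
  \<comment> \<open>Linear independence over R kills the values of the coefficients and algebraic
    independence the formal coefficients, leaving only the ideal part.\<close>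
  have kernel: "p \<in> ideal_gen relations" if p: "psubst gval p = 0" for p
  proof -
    obtain i c where ic: "i \<in> ideal_gen relations"
      "p = i + (\<Sum>k<8. psubst rgen (c k) * free_basis ! k)"
      using normal_form by blast
    have "psubst gval (\<Sum>k<8. psubst rgen (c k) * free_basis ! k) = 0"
      using p ic ideal_0 by (simp add: psubst_add)
    then have "psubst rval (c k) = 0" if "k \<in> {0, 1, 2, 3, 4, 5, 6, 7}" for k
      unfolding image using that by (auto simp: R_alg_eq dest!: R_basis_independent[rotated])
    then have "c k = 0" if "k \<in> {0, 1, 2, 3, 4, 5, 6, 7}" for k
      using that psubst_rval_eq_0D by blast
    moreover have "{..<8} = {0, 1, 2, 3, 4, 5, 6, 7::nat}" by auto
    ultimately have "p = i" using ic(2) by simp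
    with ic show ?thesis by simp
  qed
  have range_gen: "range (psubst gval) = invariants"
    by (simp add: range_psubst invariants_eq)
  show "is_presentation gval relations invariants"
    using range_gen kernel ideal_0 by (auto simp: is_presentation_def)
  \<comment> \<open>Existence: \<open>Q\<close> is lifted to the free algebra, and the normal form
    of the lift is evaluated.\<close>
  fix Q assume "Q \<in> invariants"
  then obtain p where "Q = psubst gval p"
    using range_gen by auto
  moreover obtain i c where "i \<in> ideal_gen relations"
      "p = i + (\<Sum>k<8. psubst rgen (c k) * free_basis ! k)"
    using normal_form by blast
  ultimately have Q: "Q = psubst rval (c 0) + psubst rval (c 1) * Z1 + psubst rval (c 2) * Z1^2
      + psubst rval (c 3) * Z1^3 + psubst rval (c 4) * Z1^4 + psubst rval (c 5) * Z2
      + psubst rval (c 6) * Z3 + psubst rval (c 7) * Z4"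
    by (simp add: psubst_add ideal_0 image)
  have R: "psubst rval P \<in> R_alg" for P
    by (simp add: R_alg_eq)
  have R_diff: "P - P' \<in> R_alg" if "P \<in> R_alg" "P' \<in> R_alg" for P P'
    using that unfolding R_alg_eq by (intro subalgebra_diff subalgebra_range_psubst)
  have unique: "P0 = P0' \<and> P1 = P1' \<and> P2 = P2' \<and> P3 = P3' \<and> P4 = P4' \<and> Q2 = Q2' \<and> Q3 = Q3' \<and> Q4 = Q4'"
    if "{P0, P1, P2, P3, P4, Q2, Q3, Q4} \<subseteq> R_alg" "{P0', P1', P2', P3', P4', Q2', Q3', Q4'} \<subseteq> R_alg"
      "Q = P0 + P1 * Z1 + P2 * Z1^2 + P3 * Z1^3 + P4 * Z1^4 + Q2 * Z2 + Q3 * Z3 + Q4 * Z4"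
      "Q = P0' + P1' * Z1 + P2' * Z1^2 + P3' * Z1^3 + P4' * Z1^4 + Q2' * Z2 + Q3' * Z3 + Q4' * Z4"
    for P0 P1 P2 P3 P4 Q2 Q3 Q4 P0' P1' P2' P3' P4' Q2' Q3' Q4'
  proof -
    \<comment> \<open>Two representations of \<open>Q\<close> differ by a linear relation over R
      among the basis elements, which must be trivial.\<close>
    have diffs: "{P0 - P0', P1 - P1', P2 - P2', P3 - P3', P4 - P4', Q2 - Q2', Q3 - Q3', Q4 - Q4'} \<subseteq> R_alg"
      using that(1,2) R_diff by simp
    have sum: "(P0 - P0') + (P1 - P1') * Z1 + (P2 - P2') * Z1^2 + (P3 - P3') * Z1^3
      + (P4 - P4') * Z1^4 + (Q2 - Q2') * Z2 + (Q3 - Q3') * Z3 + (Q4 - Q4') * Z4 = Q - Q"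
      by (subst (1) that(3), subst that(4)) (simp add: left_diff_distrib)
    show ?thesis
      using R_basis_independent[OF diffs sum[unfolded diff_self]] unfolding right_minus_eq .
  qed
  show "\<exists>!(P0, P1, P2, P3, P4, Q2, Q3, Q4) \<in>
           R_alg \<times> R_alg \<times> R_alg \<times> R_alg \<times> R_alg \<times> R_alg \<times> R_alg \<times> R_alg.
         Q = P0 + P1 * Z1 + P2 * Z1^2 + P3 * Z1^3 + P4 * Z1^4 + Q2 * Z2 + Q3 * Z3 + Q4 * Z4"
  proof (rule ex1I[where a = "(psubst rval (c 0), psubst rval (c 1), psubst rval (c 2), psubst rval (c 3),
        psubst rval (c 4), psubst rval (c 5), psubst rval (c 6), psubst rval (c 7))"], goal_cases)
    case 1
    then show ?case using Q R by simp
  next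
    case (2 t)
    obtain P0 P1 P2 P3 P4 Q2 Q3 Q4 where t: "t = (P0, P1, P2, P3, P4, Q2, Q3, Q4)"
      by (metis surj_pair)
    have "{P0, P1, P2, P3, P4, Q2, Q3, Q4} \<subseteq> R_alg"
      "Q = P0 + P1 * Z1 + P2 * Z1^2 + P3 * Z1^3 + P4 * Z1^4 + Q2 * Z2 + Q3 * Z3 + Q4 * Z4"
      using 2 unfolding t by simp_all
    from unique[OF this(1) _ this(2) Q] show ?case
      using R unfolding t by simp
  qed
qed

end
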